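(* Let $(X_i,d_i,\star_i)_{i\in\mathbb{N}}$ be pointed metric spaces such that every $X_i$ is geodesic and proper, and let $\pi_{i+1}:X_{i+1}\to X_i$, $i\in\mathbb{N}$, be base-point-preserving maps having the continuous path lifting property. Then the inverse limit $X_\infty$ is a complete geodesic metric space, and for each pair of points $x=(x_1,x_2,\dots),\ y=(y_1,y_2,\dots)\in X_\infty$ there are a path $\eta_\infty:[0,1]\to X_\infty$, a strictly increasing sequence $\sigma:\mathbb{N}\to\mathbb{N}$, and paths $\gamma^{\sigma(n)}:[0,1]\to X_{\sigma(n)}$, $n\in\mathbb{N}$, such that: (A) $\eta_\infty$ is a geodesic parametrized proportionally to arc length connecting $x$ with $y$ in $X_\infty$; (B) each $\gamma^{\sigma(n)}$ is a geodesic parametrized proportionally to arc length connecting $x_{\sigma(n)}$ with $y_{\sigma(n)}$; (C) $\pi^\infty_i\circ\eta_\infty=\lim_{n\to\infty}\pi^{\sigma(n)}_i\circ\gamma^{\sigma(n)}$ for all $i\in\mathbb{N}$.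
   Context: $\mathbb{N}=\{1,2,\dots\}$. Paths are continuous maps from compact intervals; $L$ denotes length, and a path is rectifiable if $L<\infty$. $\operatorname{Lip}$ denotes the Lipschitz constant. A metric space is proper if all closed balls are compact. It is geodesic if any two points $x,y$ are joined by a path of length $d(x,y)$; any such path is called a geodesic. A path $\gamma:[a,b]\to X$ is parametrized proportionally to arc length if $L(\gamma|_{[s,t]})=L(\gamma)|b-a|^{-1}|t-s|$ for all $a\le s\le t\le b$. A submetry is a 1-Lipschitz map $\pi:X\to Y$ between nonempty metric spaces such that for any $y,y'\in Y$ and $x\in X$ with $\pi(x)=y$ there is $x'\in X$ with $\pi(x')=y'$ and $d_X(x,x')=d_Y(y,y')$. A submetry $\pi:X\to Y$ has the unique path lifting property if for every rectifiable path $\gamma:[a,b]\to Y$ and each $x\in\pi^{-1}(\gamma(a))$ there is a path $\bar\gamma:[a,b]\to X$ (called a lift of $\gamma$) such that (1) $L(\bar\gamma)<\infty$; (2) $\bar\gamma(a)=x$; (3) $\pi(\bar\gamma(t))=\gamma(t)$ for all $t$; (4) any continuous path $\eta:[a,b]\to X$ satisfying (1), (2), (3) equals $\bar\gamma$; (5) $L(\bar\gamma)\le L(\gamma)$. A map $\pi:X\to Y$ has the continuous path lifting property if it has the unique path lifting property and for each $y\in Y$ and each sequence of paths $\gamma_n:[0,1]\to Y$ with $\gamma_n(0)=y$ for all $n$, $\sup_n\operatorname{Lip}(\gamma_n)<\infty$ and $\gamma_n\to\gamma$ pointwise on $[0,1]$, one has $\bar\gamma_n(t)\to\bar\gamma(t)$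 for all $t\in[0,1]$, where $\bar\gamma_n,\bar\gamma$ are the lifts of $\gamma_n,\gamma$ with the same starting point $\bar\gamma_n(0)=\bar\gamma(0)\in\pi^{-1}(y)$. For $i\ge j$, $\pi^i_j=\pi_{j+1}\circ\cdots\circ\pi_i:X_i\to X_j$ (with $\pi^i_i$ the identity). $X_\infty$ is the set of $(x_i)_{i\in\mathbb{N}}\in\prod_i X_i$ with $\pi_{i+1}(x_{i+1})=x_i$ for all $i$ and $\sup_i d_i(\star_i,x_i)<\infty$, with metric $d_\infty(x,y)=\sup_i d_i(x_i,y_i)$; $\pi^\infty_i:X_\infty\to X_i$ is $(x_j)_j\mapsto x_i$. In (C), the limit is over those $n$ with $\sigma(n)\ge i$; under the uniform bound on Lipschitz constants that holds here, pointwise and uniform convergence on $[0,1]$ are equivalent. *)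

theory Defs
  imports "HOL-Analysis.Analysis"
begin

text \<open>
  Metric spaces are carrier sets \<open>M\<close> with a distance \<open>d\<close>, as in the locale \<^locale>\<open>Metric_space\<close>.
  A path on \<open>[a,b]\<close> is a function on the reals of which only the values on \<open>{a..b}\<close> matter.
\<close>

definition path_on :: "'a set \<Rightarrow> ('a \<Rightarrow> 'a \<Rightarrow> real) \<Rightarrow> real \<Rightarrow> real \<Rightarrow> (real \<Rightarrow> 'a) \<Rightarrow> bool" where
  "path_on M d a b g \<longleftrightarrow>
     a \<le> b \<and> continuous_map (top_of_set {a..b}) (Metric_space.mtopology M d) g"

text \<open>Supremum over all partitions \<open>a = t 0 \<le> t 1 \<le> \<dots> \<le> t n = b\<close>.\<close>

definition path_len :: "('a \<Rightarrow> 'a \<Rightarrow> real) \<Rightarrow> real \<Rightarrow> real \<Rightarrow> (real \<Rightarrow> 'a) \<Rightarrow> ennreal" where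
  "path_len d a b g =
     (SUP (n, t) \<in> {(n :: nat, t :: nat \<Rightarrow> real). t 0 = a \<and> t n = b \<and> mono_on {..n} t}.
        ennreal (\<Sum>k<n. d (g (t k)) (g (t (Suc k)))))"

definition rectifiable_on :: "('a \<Rightarrow> 'a \<Rightarrow> real) \<Rightarrow> real \<Rightarrow> real \<Rightarrow> (real \<Rightarrow> 'a) \<Rightarrow> bool" where
  "rectifiable_on d a b g \<longleftrightarrow> path_len d a b g < \<infinity>"

definition proportional_to_arc_length ::
    "('a \<Rightarrow> 'a \<Rightarrow> real) \<Rightarrow> real \<Rightarrow> real \<Rightarrow> (real \<Rightarrow> 'a) \<Rightarrow> bool" where
  "proportional_to_arc_length d a b g \<longleftrightarrow>
     (\<forall>s t. a \<le> s \<and> s \<le> t \<and> t \<le> b \<longrightarrow>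
        path_len d s t g = path_len d a b g * ennreal (inverse \<bar>b - a\<bar> * \<bar>t - s\<bar>))"

definition geodesic_on ::
    "'a set \<Rightarrow> ('a \<Rightarrow> 'a \<Rightarrow> real) \<Rightarrow> real \<Rightarrow> real \<Rightarrow> (real \<Rightarrow> 'a) \<Rightarrow> 'a \<Rightarrow> 'a \<Rightarrow> bool" where
  "geodesic_on M d a b g x y \<longleftrightarrow>
     path_on M d a b g \<and> g a = x \<and> g b = y \<and> path_len d a b g = ennreal (d x y)"

definition geodesic_space :: "'a set \<Rightarrow> ('a \<Rightarrow> 'a \<Rightarrow> real) \<Rightarrow> bool" where
  "geodesic_space M d \<longleftrightarrow> (\<forall>x\<in>M. \<forall>y\<in>M. \<exists>a b g. geodesic_on M d a b g x y)"

definition proper_space :: "'a set \<Rightarrow> ('a \<Rightarrow> 'a \<Rightarrow> real) \<Rightarrow> bool" where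
  "proper_space M d \<longleftrightarrow>
     (\<forall>x\<in>M. \<forall>r. compactin (Metric_space.mtopology M d) (Metric_space.mcball M d x r))"

definition submetry ::
    "'a set \<Rightarrow> ('a \<Rightarrow> 'a \<Rightarrow> real) \<Rightarrow> 'b set \<Rightarrow> ('b \<Rightarrow> 'b \<Rightarrow> real) \<Rightarrow> ('a \<Rightarrow> 'b) \<Rightarrow> bool" where
  "submetry M d N e p \<longleftrightarrow>
     M \<noteq> {} \<and> N \<noteq> {} \<and> p \<in> M \<rightarrow> N \<and>
     (\<forall>x\<in>M. \<forall>x'\<in>M. e (p x) (p x') \<le> d x x') \<and>
     (\<forall>y\<in>N. \<forall>y'\<in>N. \<forall>x\<in>M. p x = y \<longrightarrow> (\<exists>x'\<in>M. p x' = y' \<and> d x x' = e y y'))"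

text \<open>
  Conditions (1)--(3) on a lift \<open>h\<close> of \<open>g\<close> with starting point \<open>x\<close>. Under unique path lifting they
  determine \<open>h\<close> on \<open>{a..b}\<close>, so that \<open>h\<close> is the lift of \<open>g\<close>.
\<close>

definition lift_of ::
    "'a set \<Rightarrow> ('a \<Rightarrow> 'a \<Rightarrow> real) \<Rightarrow> ('a \<Rightarrow> 'b) \<Rightarrow> real \<Rightarrow> real \<Rightarrow>
     (real \<Rightarrow> 'b) \<Rightarrow> 'a \<Rightarrow> (real \<Rightarrow> 'a) \<Rightarrow> bool" where
  "lift_of M d p a b g x h \<longleftrightarrow>
     path_on M d a b h \<and> rectifiable_on d a b h \<and> h a = x \<and> (\<forall>t\<in>{a..b}. p (h t) = g t)"

definition unique_path_lifting ::
    "'a set \<Rightarrow> ('a \<Rightarrow> 'a \<Rightarrow> real) \<Rightarrow> 'b set \<Rightarrow> ('b \<Rightarrow> 'b \<Rightarrow> real) \<Rightarrow> ('a \<Rightarrow> 'b) \<Rightarrow> bool" where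
  "unique_path_lifting M d N e p \<longleftrightarrow>
     submetry M d N e p \<and>
     (\<forall>a b g. path_on N e a b g \<and> rectifiable_on e a b g \<longrightarrow>
        (\<forall>x\<in>M. p x = g a \<longrightarrow>
           (\<exists>h. lift_of M d p a b g x h \<and>
                (\<forall>k. lift_of M d p a b g x k \<longrightarrow> (\<forall>t\<in>{a..b}. k t = h t)) \<and>
                path_len d a b h \<le> path_len e a b g)))"

definition continuous_path_lifting ::
    "'a set \<Rightarrow> ('a \<Rightarrow> 'a \<Rightarrow> real) \<Rightarrow> 'b set \<Rightarrow> ('b \<Rightarrow> 'b \<Rightarrow> real) \<Rightarrow> ('a \<Rightarrow> 'b) \<Rightarrow> bool" where
  "continuous_path_lifting M d N e p \<longleftrightarrow>
     unique_path_lifting M d N e p \<and>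
     (\<forall>y\<in>N. \<forall>(gs :: nat \<Rightarrow> real \<Rightarrow> 'b) g.
        (\<forall>n. path_on N e 0 1 (gs n) \<and> gs n 0 = y) \<and>
        (\<exists>L. \<forall>n. \<forall>s\<in>{0..1}. \<forall>t\<in>{0..1}. e (gs n s) (gs n t) \<le> L * \<bar>s - t\<bar>) \<and>
        (\<forall>t\<in>{0..1}. limitin (Metric_space.mtopology N e) (\<lambda>n. gs n t) (g t) sequentially) \<longrightarrow>
        (\<forall>x\<in>M. p x = y \<longrightarrow>
           (\<forall>hs h. (\<forall>n. lift_of M d p 0 1 (gs n) x (hs n)) \<and> lift_of M d p 0 1 g x h \<longrightarrow>
              (\<forall>t\<in>{0..1}.
                 limitin (Metric_space.mtopology M d) (\<lambda>n. hs n t) (h t) sequentially))))"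

text \<open>
  Inverse sequences are indexed from \<open>0\<close>. The bonding map \<open>p (Suc i)\<close> goes from \<open>X (Suc i)\<close> to
  \<open>X i\<close>, and \<open>p 0\<close> is never used. For \<open>j \<le> i\<close>, \<open>bond p i j = p (j + 1) \<circ> \<dots> \<circ> p i\<close>.
\<close>

definition bond :: "(nat \<Rightarrow> 'a \<Rightarrow> 'a) \<Rightarrow> nat \<Rightarrow> nat \<Rightarrow> 'a \<Rightarrow> 'a" where
  "bond p i j = foldr (\<circ>) (map p [Suc j..<Suc i]) id"

definition inv_limit ::
    "(nat \<Rightarrow> 'a set) \<Rightarrow> (nat \<Rightarrow> 'a \<Rightarrow> 'a \<Rightarrow> real) \<Rightarrow> (nat \<Rightarrow> 'a) \<Rightarrow> (nat \<Rightarrow> 'a \<Rightarrow> 'a) \<Rightarrow> (nat \<Rightarrow> 'a) set"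
  where
  "inv_limit X d star p =
     {x. (\<forall>i. x i \<in> X i) \<and> (\<forall>i. p (Suc i) (x (Suc i)) = x i) \<and>
         bdd_above (range (\<lambda>i. d i (star i) (x i)))}"

text \<open>
  The value \<open>0\<close> off the carrier is needed because \<^locale>\<open>Metric_space\<close> requires the distance to be
  nonnegative on the whole type, while the real supremum of an unbounded set is unspecified.
\<close>

definition inv_limit_dist ::
    "(nat \<Rightarrow> 'a set) \<Rightarrow> (nat \<Rightarrow> 'a \<Rightarrow> 'a \<Rightarrow> real) \<Rightarrow> (nat \<Rightarrow> 'a) \<Rightarrow> (nat \<Rightarrow> 'a \<Rightarrow> 'a) \<Rightarrow>
     (nat \<Rightarrow> 'a) \<Rightarrow> (nat \<Rightarrow> 'a) \<Rightarrow> real" where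
  "inv_limit_dist X d star p x y =
     (if x \<in> inv_limit X d star p \<and> y \<in> inv_limit X d star p
      then SUP i. d i (x i) (y i) else 0)"

definition inv_limit_proj :: "nat \<Rightarrow> (nat \<Rightarrow> 'a) \<Rightarrow> 'a" where
  "inv_limit_proj i x = x i"

end

theory Submission
  imports Defs "HOL-Library.Diagonal_Subsequence"
begin

text \<open>
  Fix points \<open>x\<close>, \<open>y\<close> of the inverse limit at distance \<open>D\<close>, and join \<open>x n\<close> to \<open>y n\<close> by a geodesic
  \<open>\<gamma> n\<close> of constant speed \<open>d n (x n) (y n) \<le> D\<close>. Bonding maps are 1-Lipschitz, so the image of \<open>\<gamma> n\<close>
  in \<open>X i\<close>, for \<open>n \<ge> i\<close>, is a \<open>D\<close>-Lipschitz path from \<open>x i\<close> to \<open>y i\<close>, and it stays in the closed ball of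
  radius \<open>D\<close> about \<open>x i\<close>. This ball is compact because \<open>X i\<close> is proper. A single diagonal subsequence
  therefore makes the images converge at all times and in all the \<open>X i\<close> at once
  (\<open>arzela_ascoli_diagonal\<close>).
  
  Continuity of the bonding maps makes the limits \<open>\<eta> t i\<close> compatible, so that \<open>\<eta> t\<close> is a thread. It
  lies at bounded distance from \<open>x\<close>, hence in the inverse limit. Taking the supremum over \<open>i\<close> shows that
  \<open>\<eta>\<close> is \<open>D\<close>-Lipschitz for the limit metric. But \<open>\<eta>\<close> joins two points at distance exactly \<open>D\<close> in time 1,
  so no estimate can be strict: \<open>d_inf (\<eta> s) (\<eta> t) = D * \<bar>s - t\<bar>\<close>
  (\<open>constant_speed_if_lipschitz_const_minimal\<close>). Such a map is a geodesic parametrized proportionally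
  to arc length, so that \<open>\<eta>\<close> and the \<open>\<gamma> n\<close> have the required properties.
  
  Completeness is coordinatewise: proper spaces are complete, a Cauchy sequence of threads is Cauchy in
  every coordinate, and Cauchy estimates uniform in the coordinate pass to the limit.
\<close>

section \<open>Geodesics of constant speed\<close>

context Metric_space
begin

lemma path_on_lipschitz:
  assumes "a \<le> b"
    and c_in: "\<And>t. t \<in> {a..b} \<Longrightarrow> c t \<in> M"
    and lip: "\<And>s t. s \<in> {a..b} \<Longrightarrow> t \<in> {a..b} \<Longrightarrow> d (c s) (c t) \<le> L * \<bar>s - t\<bar>"
  shows "path_on M d a b c"
  unfolding path_on_def continuous_map_to_metric
proof (intro conjI ballI allI impI)
  fix s and \<epsilon> :: real
  assume s: "s \<in> topspace (top_of_set {a..b})" and "\<epsilon> > 0"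
  \<comment> \<open>Adding 1 keeps the denominator positive when \<open>L = 0\<close>.\<close>
  define \<delta> where "\<delta> = \<epsilon> / (\<bar>L\<bar> + 1)"
  have "\<delta> > 0"
    using \<open>\<epsilon> > 0\<close> by (simp add: \<delta>_def)
  have "c t \<in> mball (c s) \<epsilon>" if t: "t \<in> {a..b} \<inter> ball s \<delta>" for t
  proof -
    have "d (c s) (c t) \<le> L * \<bar>s - t\<bar>"
      using lip s t by simp
    also have "\<dots> \<le> (\<bar>L\<bar> + 1) * \<bar>s - t\<bar>"
      by (intro mult_right_mono) auto
    also have "\<dots> < (\<bar>L\<bar> + 1) * \<delta>"
      using t by (intro mult_strict_left_mono) (auto simp: dist_real_def)
    also have "\<dots> = \<epsilon>"
      by (simp add: \<delta>_def)
    finally show ?thesis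
      using c_in s t by simp
  qed
  moreover have "openin (top_of_set {a..b}) ({a..b} \<inter> ball s \<delta>)"
    by (simp add: openin_open_Int)
  moreover have "s \<in> {a..b} \<inter> ball s \<delta>"
    using s \<open>\<delta> > 0\<close> by simp
  ultimately show "\<exists>U. openin (top_of_set {a..b}) U \<and> s \<in> U \<and> (\<forall>t\<in>U. c t \<in> mball (c s) \<epsilon>)"
    by blast
qed (fact \<open>a \<le> b\<close>)

lemma continuous_map_mdist_from:
  assumes "x \<in> M"
  shows "continuous_map mtopology euclideanreal (d x)"
proof -
  have "\<bar>d x y - d x z\<bar> < \<epsilon>" if "y \<in> M" "z \<in> M" "d y z < \<epsilon>" for y z \<epsilon>
    using mdist_reverse_triangle[of y x z] that assms by (simp add: commute)
  then show ?thesis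
    using metric_continuous_map[OF Met_TC.Metric_space_axioms, of "d x"]
    by (force simp: dist_real_def)
qed

text \<open>
  On a path of constant speed every partition yields the same telescoping sum, so the supremum is
  attained by all of them.
\<close>

lemma path_len_constant_speed:
  assumes "a \<le> b"
    and speed: "\<And>s t. a \<le> s \<Longrightarrow> s \<le> t \<Longrightarrow> t \<le> b \<Longrightarrow> d (c s) (c t) = L * (t - s)"
  shows "path_len d a b c = ennreal (L * (b - a))"
proof -
  let ?P = "{(n :: nat, t :: nat \<Rightarrow> real). t 0 = a \<and> t n = b \<and> mono_on {..n} t}"
  have sum: "(\<Sum>k<n. d (c (t k)) (c (t (Suc k)))) = L * (b - a)" if "(n, t) \<in> ?P" for n t
  proof -
    have "t 0 = a" "t n = b" and mono: "mono_on {..n} t"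
      using that by auto
    then have "a \<le> t k \<and> t k \<le> t (Suc k) \<and> t (Suc k) \<le> b" if "k < n" for k
      using that mono_onD[OF mono, of 0 k] mono_onD[OF mono, of k "Suc k"]
        mono_onD[OF mono, of "Suc k" n] by auto
    then have "(\<Sum>k<n. d (c (t k)) (c (t (Suc k)))) = (\<Sum>k<n. L * (t (Suc k) - t k))"
      by (intro sum.cong) (auto intro!: speed)
    also have "\<dots> = L * (t n - t 0)"
      by (simp add: sum_distrib_left[symmetric] sum_lessThan_telescope)
    finally show ?thesis
      using \<open>t 0 = a\<close> \<open>t n = b\<close> by simp
  qed
  have "(1, \<lambda>k. if k = 0 then a else b) \<in> ?P"
    using \<open>a \<le> b\<close> by (auto simp: mono_on_def)
  then have "?P \<noteq> {}"
    by blast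
  have "path_len d a b c = (SUP nt\<in>?P. ennreal (L * (b - a)))"
    unfolding path_len_def by (intro SUP_cong refl) (auto simp: sum)
  then show ?thesis
    using \<open>?P \<noteq> {}\<close> by simp
qed

text \<open>
  Every geodesic below is produced as a map of constant speed. Both properties follow from the value of
  the length on all subintervals.
\<close>

lemma constant_speed_geodesic:
  assumes c_in: "\<And>t. t \<in> {0..1} \<Longrightarrow> c t \<in> M"
    and speed: "\<And>s t. s \<in> {0..1} \<Longrightarrow> t \<in> {0..1} \<Longrightarrow> d (c s) (c t) = d x y * \<bar>s - t\<bar>"
    and ends: "c 0 = x" "c 1 = y"
  shows "geodesic_on M d 0 1 c x y" "proportional_to_arc_length d 0 1 c"
proof -
  have len: "path_len d s t c = ennreal (d x y * (t - s))" if "0 \<le> s" "s \<le> t" "t \<le> 1" for s t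
    by (rule path_len_constant_speed[OF \<open>s \<le> t\<close>]) (use that speed in auto)
  have "path_on M d 0 1 c"
    by (rule path_on_lipschitz[OF zero_le_one c_in eq_refl[OF speed]])
  then show "geodesic_on M d 0 1 c x y"
    using len[of 0 1] ends by (simp add: geodesic_on_def)
  show "proportional_to_arc_length d 0 1 c"
    unfolding proportional_to_arc_length_def by (auto simp: len ennreal_mult)
qed

text \<open>
  No time can be made up: a path that lags behind between \<open>s\<close> and \<open>t\<close> would have to cover the remaining
  distance on \<open>[0, s]\<close> and \<open>[t, 1]\<close> faster than its Lipschitz constant permits.
\<close>

lemma constant_speed_if_lipschitz_const_minimal:
  assumes c_in: "\<And>t. t \<in> {0..1} \<Longrightarrow> c t \<in> M"
    and lip: "\<And>s t. s \<in> {0..1} \<Longrightarrow> t \<in> {0..1} \<Longrightarrow> d (c s) (c t) \<le> d (c 0) (c 1) * \<bar>s - t\<bar>"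
    and s: "s \<in> {0..1}" and t: "t \<in> {0..1}"
  shows "d (c s) (c t) = d (c 0) (c 1) * \<bar>s - t\<bar>"
proof -
  let ?D = "d (c 0) (c 1)"
  have *: "?D * (t - s) \<le> d (c s) (c t)" if "s \<in> {0..1}" "t \<in> {0..1}" "s \<le> t" for s t
  proof -
    have "?D \<le> d (c 0) (c s) + d (c s) (c t) + d (c t) (c 1)"
      using triangle[of "c 0" "c s" "c 1"] triangle[of "c s" "c t" "c 1"] that c_in by fastforce
    also have "\<dots> \<le> ?D * s + d (c s) (c t) + ?D * (1 - t)"
      using lip[of 0 s] lip[of t 1] that by auto
    finally show ?thesis
      by (simp add: algebra_simps)
  qed
  show ?thesis
  proof (rule antisym)
    show "?D * \<bar>s - t\<bar> \<le> d (c s) (c t)"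
      using *[of s t] *[of t s] s t by (cases "s \<le> t") (auto simp: commute)
  qed (use lip s t in auto)
qed

text \<open>
  The partition \<open>a \<le> s \<le> t \<le> b\<close> bounds \<open>d x (g s) + d (g s) (g t) + d (g t) y\<close> by the length \<open>d x y\<close>, so all
  triangle inequalities between these points are equalities. The distance from the initial point thus
  serves as an arc length parameter.
\<close>

lemma dist_along_geodesic:
  assumes geo: "geodesic_on M d a b g x y" and st: "a \<le> s" "s \<le> t" "t \<le> b"
  shows "d x (g t) = d x (g s) + d (g s) (g t)"
proof -
  have "g ` {a..b} \<subseteq> M" and ends: "g a = x" "g b = y"
    and len: "path_len d a b g = ennreal (d x y)"
    using geo continuous_map_image_subset_topspace[of "top_of_set {a..b}" mtopology g]
    by (auto simp: geodesic_on_def path_on_def)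
  then have in_M: "x \<in> M" "g s \<in> M" "g t \<in> M" "y \<in> M"
    using st by auto
  define u :: "nat \<Rightarrow> real" where "u k = [a, s, t, b] ! k" for k
  have "mono_on {..3} u"
  proof (rule mono_onI)
    fix i j :: nat assume "i \<in> {..3}" "j \<in> {..3}" "i \<le> j"
    then have "i \<in> {0, 1, 2, 3}" "j \<in> {0, 1, 2, 3}" "i \<le> j"
      by auto
    then show "u i \<le> u j"
      using st by (auto simp: u_def)
  qed
  moreover have "u 0 = a" "u 3 = b"
    by (simp_all add: u_def)
  ultimately have "ennreal (\<Sum>k<3. d (g (u k)) (g (u (Suc k)))) \<le> path_len d a b g"
    unfolding path_len_def by (intro SUP_upper2[of "(3, u)"]) auto
  then have "d x (g s) + d (g s) (g t) + d (g t) y \<le> d x y"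
    using ends by (simp add: len u_def lessThan_Suc numeral_3_eq_3 algebra_simps del: ennreal_plus)
  moreover have "d x y \<le> d x (g t) + d (g t) y" "d x (g t) \<le> d x (g s) + d (g s) (g t)"
    using in_M by (auto intro: triangle)
  ultimately show ?thesis
    by simp
qed

text \<open>
  By the intermediate value theorem the distance from \<open>x\<close> takes every value \<open>d x y * t\<close> along the
  geodesic, and by \<open>dist_along_geodesic\<close> it measures distances between points of the geodesic. Any choice
  of times at which these values are taken gives constant speed. The choice need not be continuous:
  the geodesic may rest, but then all choices give the same point.
\<close>

lemma geodesic_reparametrize:
  assumes geo: "geodesic_on M d a b g x y"
  obtains c where "\<And>t. t \<in> {0..1} \<Longrightarrow> c t \<in> M"
    and "\<And>s t. s \<in> {0..1} \<Longrightarrow> t \<in> {0..1} \<Longrightarrow> d (c s) (c t) = d x y * \<bar>s - t\<bar>"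
    and "c 0 = x" and "c 1 = y"
proof -
  have "a \<le> b" and cont: "continuous_map (top_of_set {a..b}) mtopology g"
    and ends: "g a = x" "g b = y"
    using geo by (auto simp: geodesic_on_def path_on_def)
  have g_in: "g r \<in> M" if "r \<in> {a..b}" for r
    using continuous_map_image_subset_topspace[OF cont] that by auto
  have "x \<in> M" "y \<in> M"
    using g_in[of a] g_in[of b] ends \<open>a \<le> b\<close> by auto
  have "continuous_on {a..b} (\<lambda>r. d x (g r))"
    using continuous_map_compose[OF cont continuous_map_mdist_from[OF \<open>x \<in> M\<close>]]
    by (simp add: o_def)
  then have "\<exists>r\<in>{a..b}. d x (g r) = d x y * t" if "t \<in> {0..1}" for t
    using IVT'[of "\<lambda>r. d x (g r)" a "d x y * t" b] that \<open>a \<le> b\<close> ends \<open>x \<in> M\<close>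
    by (auto simp: mult_left_le)
  then obtain r where r: "\<And>t. t \<in> {0..1} \<Longrightarrow> r t \<in> {a..b}"
    and r_dist: "\<And>t. t \<in> {0..1} \<Longrightarrow> d x (g (r t)) = d x y * t"
    by metis
  show thesis
  proof
    show "g (r t) \<in> M" if "t \<in> {0..1}" for t
      using g_in r that by blast
    show "d (g (r s)) (g (r t)) = d x y * \<bar>s - t\<bar>" if "s \<in> {0..1}" "t \<in> {0..1}" for s t
    proof -
      have "d (g (r s)) (g (r t)) = \<bar>d x (g (r s)) - d x (g (r t))\<bar>"
        using dist_along_geodesic[OF geo, of "r s" "r t"] dist_along_geodesic[OF geo, of "r t" "r s"]
          r[OF that(1)] r[OF that(2)] by (cases "r s \<le> r t") (auto simp: commute)
      then show ?thesis
        using that by (simp add: r_dist right_diff_distrib[symmetric] abs_mult)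
    qed
    show "g (r 0) = x"
      using r_dist[of 0] r[of 0] g_in \<open>x \<in> M\<close> by auto
    have "d x y = d x (g (r 1)) + d (g (r 1)) y"
      using dist_along_geodesic[OF geo, of "r 1" b] r[of 1] ends by auto
    then show "g (r 1) = y"
      using r_dist[of 1] r[of 1] g_in \<open>y \<in> M\<close> by auto
  qed
qed

section \<open>Subsequential limits of equi-Lipschitz paths\<close>

lemma proper_space_mcomplete:
  assumes "proper_space M d"
  shows "mcomplete"
  unfolding mcomplete_def
proof (intro allI impI)
  fix \<sigma> assume \<sigma>: "MCauchy \<sigma>"
  then obtain z B where "range \<sigma> \<subseteq> mcball z B"
    using MCauchy_imp_mbounded mbounded_def by blast
  moreover from this have "z \<in> M"
    using in_mcball by blast
  then have "compactin mtopology (mcball z B)"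
    using assms by (auto simp: proper_space_def)
  ultimately obtain l r where "strict_mono r" "limitin mtopology (\<sigma> \<circ> r) l sequentially"
    unfolding compactin_sequentially by meson
  then show "\<exists>l. limitin mtopology \<sigma> l sequentially"
    using MCauchy_convergent_subsequence \<sigma> by blast
qed

lemma limitin_dist_le:
  assumes f: "limitin mtopology f l sequentially" and g: "limitin mtopology g m sequentially"
    and le: "\<And>n. n \<ge> N \<Longrightarrow> d (f n) (g n) \<le> B"
  shows "d l m \<le> B"
proof (rule field_le_epsilon)
  fix \<epsilon> :: real assume "\<epsilon> > 0"
  then obtain N1 N2 where N1: "\<And>n. n \<ge> N1 \<Longrightarrow> f n \<in> M \<and> d (f n) l < \<epsilon> / 2"
    and N2: "\<And>n. n \<ge> N2 \<Longrightarrow> g n \<in> M \<and> d (g n) m < \<epsilon> / 2"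
    using f g unfolding limit_metric_sequentially by (meson half_gt_zero)
  let ?n = "N + N1 + N2"
  have "l \<in> M" "m \<in> M" "f ?n \<in> M" "g ?n \<in> M"
    using f g limitin_mspace N1 N2 by auto
  moreover have "d (f ?n) l < \<epsilon> / 2" "d (g ?n) m < \<epsilon> / 2" "d (f ?n) (g ?n) \<le> B"
    using N1 N2 le by auto
  ultimately show "d l m \<le> B + \<epsilon>"
    using triangle[of l "f ?n" m] triangle[of "f ?n" "g ?n" m] commute[of "f ?n" l] by linarith
qed

text \<open>
  A three-epsilon argument: at a rational time close to \<open>t\<close> the sequence is Cauchy, and moving back to \<open>t\<close>
  costs little, uniformly in \<open>n\<close>. Compactness of \<open>K\<close> then supplies the limit.
\<close>

lemma equilipschitz_limit_from_dense:
  assumes f_in: "\<And>n t. t \<in> {0..1} \<Longrightarrow> f n t \<in> K" and K: "compactin mtopology K"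
    and lip: "\<And>n s t. s \<in> {0..1} \<Longrightarrow> t \<in> {0..1} \<Longrightarrow> d (f n s) (f n t) \<le> L * \<bar>s - t\<bar>"
    and rat: "\<And>q. q \<in> \<rat> \<inter> {0..1} \<Longrightarrow> \<exists>l. limitin mtopology (\<lambda>n. f n q) l sequentially"
    and t: "t \<in> {0..1::real}"
  shows "\<exists>l. limitin mtopology (\<lambda>n. f n t) l sequentially"
proof -
  have "K \<subseteq> M"
    using K by (simp add: compactin_sequentially)
  then have f_M: "f n s \<in> M" if "s \<in> {0..1}" for n s
    using f_in that by blast
  have cauchy: "MCauchy (\<lambda>n. f n t)"
    unfolding MCauchy_def
  proof (intro conjI allI impI)
    show "range (\<lambda>n. f n t) \<subseteq> M"
      using f_M t by blast
    fix \<epsilon> :: real assume "\<epsilon> > 0"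
    define \<delta> where "\<delta> = \<epsilon> / 3 / (\<bar>L\<bar> + 1)"
    have "\<delta> > 0"
      using \<open>\<epsilon> > 0\<close> by (simp add: \<delta>_def)
    then have "max 0 (t - \<delta>) < min 1 (t + \<delta>)"
      using t by auto
    then obtain q where q: "q \<in> \<rat>" "max 0 (t - \<delta>) < q" "q < min 1 (t + \<delta>)"
      using Rats_dense_in_real by blast
    then have q01: "q \<in> {0..1}" and "\<bar>q - t\<bar> < \<delta>"
      by auto
    have near: "d (f n t) (f n q) < \<epsilon> / 3" for n
    proof -
      have "d (f n t) (f n q) \<le> L * \<bar>t - q\<bar>"
        using lip t q01 by blast
      also have "\<dots> \<le> (\<bar>L\<bar> + 1) * \<bar>t - q\<bar>"
        by (intro mult_right_mono) auto
      also have "\<dots> < (\<bar>L\<bar> + 1) * \<delta>"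
        using \<open>\<bar>q - t\<bar> < \<delta>\<close> by (intro mult_strict_left_mono) auto
      also have "\<dots> = \<epsilon> / 3"
        using abs_ge_zero[of L] unfolding \<delta>_def by (subst times_divide_eq_right, intro nonzero_mult_div_cancel_left) linarith
      finally show ?thesis .
    qed
    have "MCauchy (\<lambda>n. f n q)"
      using rat q q01 f_M convergent_imp_MCauchy by (metis IntI image_subsetI)
    then obtain N where N: "\<And>n m. n \<ge> N \<Longrightarrow> m \<ge> N \<Longrightarrow> d (f n q) (f m q) < \<epsilon> / 3"
      unfolding MCauchy_def using \<open>\<epsilon> > 0\<close> by (meson divide_pos_pos zero_less_numeral)
    have "d (f n t) (f m t) < \<epsilon>" if "n \<ge> N" "m \<ge> N" for n m
      using triangle[of "f n t" "f n q" "f m t"] triangle[of "f n q" "f m q" "f m t"]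
        near[of n] near[of m] N[OF that] f_M t q01 commute[of "f m q" "f m t"]
      by fastforce
    then show "\<exists>N. \<forall>n n'. N \<le> n \<longrightarrow> N \<le> n' \<longrightarrow> d (f n t) (f n' t) < \<epsilon>"
      by blast
  qed
  have "range (\<lambda>n. f n t) \<subseteq> K"
    using f_in t by blast
  then obtain l r where "strict_mono r" "limitin mtopology ((\<lambda>n. f n t) \<circ> r) l sequentially"
    using K unfolding compactin_sequentially by meson
  then show ?thesis
    using MCauchy_convergent_subsequence[OF cauchy] by blast
qed

end

text \<open>
  The diagonal procedure runs over the countably many pairs of a coordinate and a rational time; one
  subsequence then serves all coordinates at all real times by \<open>equilipschitz_limit_from_dense\<close>.
\<close>

lemma arzela_ascoli_diagonal:
  fixes f :: "nat \<Rightarrow> nat \<Rightarrow> real \<Rightarrow> 'a"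
  assumes metric: "\<And>i. Metric_space (X i) (d i)"
    and K: "\<And>i. compactin (Metric_space.mtopology (X i) (d i)) (K i)"
    and f_in: "\<And>i n t. t \<in> {0..1} \<Longrightarrow> f i n t \<in> K i"
    and lip: "\<And>i n s t. s \<in> {0..1} \<Longrightarrow> t \<in> {0..1} \<Longrightarrow>
                d i (f i n s) (f i n t) \<le> L * \<bar>s - t\<bar>"
  obtains \<sigma> \<eta> where "strict_mono \<sigma>"
    and "\<And>i t. t \<in> {0..1} \<Longrightarrow>
           limitin (Metric_space.mtopology (X i) (d i)) (\<lambda>n. f i (\<sigma> n) t) (\<eta> i t) sequentially"
proof -
  let ?T = "\<lambda>i. Metric_space.mtopology (X i) (d i)"
  define Q where "Q = (UNIV :: nat set) \<times> (\<rat> \<inter> {0..1 :: real})"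
  have "(0, 0) \<in> Q"
    by (simp add: Q_def)
  then have "Q \<noteq> {}"
    by blast
  have "countable Q"
    unfolding Q_def by (intro countable_SIGMA countable_Int1 countable_rat countableI_type)
  note Q = \<open>countable Q\<close> \<open>Q \<noteq> {}\<close>
  define e where "e = from_nat_into Q"
  define P where "P k s \<longleftrightarrow>
    (\<exists>l. limitin (?T (fst (e k))) (\<lambda>n. f (fst (e k)) (s n) (snd (e k))) l sequentially)" for k s
  interpret subseqs P
  proof
    fix k and s :: "nat \<Rightarrow> nat"
    interpret M: Metric_space "X (fst (e k))" "d (fst (e k))"
      by (rule metric)
    have "e k \<in> Q"
      unfolding e_def by (rule from_nat_into[OF Q(2)])
    then have "snd (e k) \<in> {0..1}"
      by (simp add: Q_def mem_Times_iff)
    then have "range (\<lambda>n. f (fst (e k)) (s n) (snd (e k))) \<subseteq> K (fst (e k))"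
      using f_in by blast
    then obtain l r where "strict_mono r"
        "limitin M.mtopology ((\<lambda>n. f (fst (e k)) (s n) (snd (e k))) \<circ> r) l sequentially"
      using K[of "fst (e k)"] unfolding M.compactin_sequentially by meson
    then show "\<exists>r. strict_mono r \<and> P k (s \<circ> r)"
      by (auto simp: P_def o_def)
  qed
  have "P k (diagseq \<circ> (+) (Suc k))" for k
  proof (rule diagseq_holds)
    fix r s :: "nat \<Rightarrow> nat" and k
    assume "strict_mono r" "P k s"
    then obtain l where
        "limitin (?T (fst (e k))) (\<lambda>n. f (fst (e k)) (s n) (snd (e k))) l sequentially"
      by (auto simp: P_def)
    from limitin_subsequence[OF \<open>strict_mono r\<close> this] show "P k (s \<circ> r)"
      by (auto simp: P_def o_def)
  qed
  then have rat: "\<exists>l. limitin (?T i) (\<lambda>n. f i (diagseq n) q) l sequentially"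
    if q: "q \<in> \<rat> \<inter> {0..1}" for i q
  proof -
    have "(i, q) \<in> Q"
      using q by (simp add: Q_def)
    then obtain k where k: "e k = (i, q)"
      using from_nat_into_surj[OF Q(1)] by (metis e_def)
    have "P k (diagseq \<circ> (+) (Suc k))"
      by fact
    then obtain l where "limitin (?T i) (\<lambda>n. f i (diagseq (n + Suc k)) q) l sequentially"
      by (auto simp: P_def k add.commute)
    then show ?thesis
      using limitin_sequentially_offset_rev[of "?T i" "\<lambda>n. f i (diagseq n) q" "Suc k"] by blast
  qed
  have lim: "\<exists>l. limitin (?T i) (\<lambda>n. f i (diagseq n) t) l sequentially" if "t \<in> {0..1}" for i t
    using Metric_space.equilipschitz_limit_from_dense[OF metric, of "\<lambda>n. f i (diagseq n)" "K i" i L t]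
      f_in K lip rat that by blast
  show thesis
    by (rule that[OF subseq_diagseq], rule someI_ex, rule lim)
qed

section \<open>Inverse limits of 1-Lipschitz maps\<close>

lemma bond_self [simp]: "bond p n n = id"
  by (simp add: bond_def)

lemma bond_step: "i < n \<Longrightarrow> bond p n i = p (Suc i) \<circ> bond p n (Suc i)"
  by (simp add: bond_def upt_conv_Cons del: upt_Suc)

locale inverse_sequence =
  fixes X :: "nat \<Rightarrow> 'a set"
    and d :: "nat \<Rightarrow> 'a \<Rightarrow> 'a \<Rightarrow> real"
    and star :: "nat \<Rightarrow> 'a"
    and p :: "nat \<Rightarrow> 'a \<Rightarrow> 'a"
  assumes metric: "\<And>i. Metric_space (X i) (d i)"
    and star_in: "\<And>i. star i \<in> X i"
    and bonding_in: "\<And>i x. x \<in> X (Suc i) \<Longrightarrow> p (Suc i) x \<in> X i"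
    and bonding_short: "\<And>i x y. x \<in> X (Suc i) \<Longrightarrow> y \<in> X (Suc i) \<Longrightarrow>
          d i (p (Suc i) x) (p (Suc i) y) \<le> d (Suc i) x y"
begin

sublocale S: Metric_space "X i" "d i" for i
  by (rule metric)

abbreviation "X_inf \<equiv> inv_limit X d star p"
abbreviation "d_inf \<equiv> inv_limit_dist X d star p"

lemma inv_limit_in: "x \<in> X_inf \<Longrightarrow> x i \<in> X i"
  and inv_limit_thread: "x \<in> X_inf \<Longrightarrow> p (Suc i) (x (Suc i)) = x i"
  by (auto simp: inv_limit_def)

text \<open>
  The condition of bounded distance from the base points is inherited from a nearby thread.
\<close>

lemma inv_limitI_bounded:
  assumes x: "x \<in> X_inf"
    and z: "\<And>i. z i \<in> X i" "\<And>i. p (Suc i) (z (Suc i)) = z i"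
    and near: "\<And>i. d i (x i) (z i) \<le> B"
  shows "z \<in> X_inf"
proof -
  obtain A where A: "\<And>i. d i (star i) (x i) \<le> A"
    using x by (auto simp: inv_limit_def bdd_above_def)
  have "d i (star i) (z i) \<le> A + B" for i
    using S.triangle[of "star i" i "x i" "z i"] A[of i] near[of i] star_in z inv_limit_in[OF x]
    by fastforce
  then show ?thesis
    using z by (auto simp: inv_limit_def bdd_above_def)
qed

lemma bdd_above_coordinate_dist:
  assumes "x \<in> X_inf" "y \<in> X_inf"
  shows "bdd_above (range (\<lambda>i. d i (x i) (y i)))"
proof -
  obtain A B where A: "\<And>i. d i (star i) (x i) \<le> A" and B: "\<And>i. d i (star i) (y i) \<le> B"
    using assms by (auto simp: inv_limit_def bdd_above_def)
  have "d i (x i) (y i) \<le> A + B" for i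
    using S.triangle[of "x i" i "star i" "y i"] A[of i] B[of i] star_in inv_limit_in assms
      S.commute[of i "x i" "star i"] by fastforce
  then show ?thesis
    by (rule bdd_aboveI2)
qed

lemma coordinate_dist_le:
  assumes "x \<in> X_inf" "y \<in> X_inf"
  shows "d i (x i) (y i) \<le> d_inf x y"
  using assms cSUP_upper[OF UNIV_I bdd_above_coordinate_dist[OF assms]]
  by (simp add: inv_limit_dist_def)

lemma inv_limit_dist_least:
  assumes "x \<in> X_inf" "y \<in> X_inf" "\<And>i. d i (x i) (y i) \<le> B"
  shows "d_inf x y \<le> B"
  using assms by (auto simp: inv_limit_dist_def intro!: cSUP_least)

lemma Metric_space_inv_limit: "Metric_space X_inf d_inf"
proof
  fix x y
  show "0 \<le> d_inf x y"
  proof (cases "x \<in> X_inf \<and> y \<in> X_inf")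
    case True
    then show ?thesis
      using coordinate_dist_le[of x y 0] S.nonneg[of 0 "x 0" "y 0"] by linarith
  qed (auto simp: inv_limit_dist_def)
  show "d_inf x y = d_inf y x"
    by (simp add: inv_limit_dist_def S.commute conj_commute)
next
  fix x y assume xy: "x \<in> X_inf" "y \<in> X_inf"
  have "x i = y i" if "d_inf x y = 0" for i
    using coordinate_dist_le[OF xy, of i] that S.zero[of "x i" i "y i"] S.nonneg[of i "x i" "y i"]
      inv_limit_in xy by force
  moreover have "d_inf x x = 0"
    using xy by (simp add: inv_limit_dist_def inv_limit_in)
  ultimately show "d_inf x y = 0 \<longleftrightarrow> x = y"
    by auto
next
  fix x y z assume xyz: "x \<in> X_inf" "y \<in> X_inf" "z \<in> X_inf"
  show "d_inf x z \<le> d_inf x y + d_inf y z"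
  proof (rule inv_limit_dist_least)
    show "d i (x i) (z i) \<le> d_inf x y + d_inf y z" for i
      using S.triangle[OF xyz[THEN inv_limit_in], of i] coordinate_dist_le[OF xyz(1,2), of i]
        coordinate_dist_le[OF xyz(2,3), of i] by linarith
  qed (use xyz in auto)
qed

sublocale L: Metric_space X_inf d_inf
  by (rule Metric_space_inv_limit)

text \<open>
  Threads survive coordinatewise limits. The compatibility is required only eventually because a path
  in \<open>X n\<close> has images in \<open>X i\<close> only for \<open>i \<le> n\<close>.
\<close>

lemma limit_thread:
  assumes lim: "\<And>i. limitin (S.mtopology i) (f i) (z i) sequentially"
    and thread: "\<And>i. eventually (\<lambda>n. p (Suc i) (f (Suc i) n) = f i n) sequentially"
  shows "p (Suc i) (z (Suc i)) = z i"
proof -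
  have "\<forall>a\<in>X (Suc i). \<forall>\<epsilon>>0. \<exists>\<delta>>0. \<forall>x. x \<in> X (Suc i) \<and> d (Suc i) a x < \<delta> \<longrightarrow>
          d i (p (Suc i) a) (p (Suc i) x) < \<epsilon>"
    using bonding_short by (meson order_le_less_trans)
  then have "continuous_map (S.mtopology (Suc i)) (S.mtopology i) (p (Suc i))"
    using S.metric_continuous_map[OF metric] bonding_in by blast
  from continuous_map_limit[OF this lim]
  have "limitin (S.mtopology i) (p (Suc i) \<circ> f (Suc i)) (p (Suc i) (z (Suc i))) sequentially" .
  then have "limitin (S.mtopology i) (f i) (p (Suc i) (z (Suc i))) sequentially"
    by (rule limitin_transform_eventually[rotated]) (use thread in simp)
  then show ?thesis
    by (rule S.limitin_metric_unique[OF _ lim trivial_limit_sequentially])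
qed

lemma mcomplete_inv_limit:
  assumes complete: "\<And>i. S.mcomplete i"
  shows "L.mcomplete"
  unfolding L.mcomplete_def
proof (intro allI impI)
  fix u assume u: "L.MCauchy u"
  then have u_in: "u n \<in> X_inf" for n
    by (auto simp: L.MCauchy_def)
  have "S.MCauchy i (\<lambda>n. u n i)" for i
    unfolding S.MCauchy_def
  proof (intro conjI allI impI)
    show "range (\<lambda>n. u n i) \<subseteq> X i"
      using u_in inv_limit_in by blast
    show "\<exists>N. \<forall>n n'. N \<le> n \<longrightarrow> N \<le> n' \<longrightarrow> d i (u n i) (u n' i) < \<epsilon>" if "\<epsilon> > 0" for \<epsilon>
      using u that coordinate_dist_le[OF u_in u_in] unfolding L.MCauchy_def
      by (meson order_le_less_trans)
  qed
  then have "\<forall>i. \<exists>l. limitin (S.mtopology i) (\<lambda>n. u n i) l sequentially"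
    using complete unfolding S.mcomplete_def by blast
  from choice[OF this]
  obtain z where z: "\<And>i. limitin (S.mtopology i) (\<lambda>n. u n i) (z i) sequentially"
    by blast
  \<comment> \<open>The bound is uniform in the coordinate \<open>i\<close>, so it also bounds the supremum metric.\<close>
  have close: "d i (u n i) (z i) \<le> \<epsilon>"
    if "\<And>m. m \<ge> N \<Longrightarrow> d_inf (u n) (u m) \<le> \<epsilon>" for i n N \<epsilon>
  proof (rule S.limitin_dist_le[OF _ z])
    show "limitin (S.mtopology i) (\<lambda>_. u n i) (u n i) sequentially"
      using u_in inv_limit_in by (simp add: limitin_const_iff)
    show "d i (u n i) (u m i) \<le> \<epsilon>" if "m \<ge> N" for m
      using coordinate_dist_le[OF u_in u_in] \<open>\<And>m. m \<ge> N \<Longrightarrow> d_inf (u n) (u m) \<le> \<epsilon>\<close>[OF that]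
      by (rule order_trans)
  qed
  have cauchy: "\<forall>\<epsilon>>0. \<exists>N. \<forall>n\<ge>N. \<forall>m\<ge>N. d_inf (u n) (u m) < \<epsilon>"
    using u by (simp add: L.MCauchy_def)
  have z_thread: "p (Suc i) (z (Suc i)) = z i" for i
    by (rule limit_thread[OF z]) (simp add: inv_limit_thread u_in)
  obtain N where "\<forall>n\<ge>N. \<forall>m\<ge>N. d_inf (u n) (u m) < 1"
    using cauchy[rule_format, of 1] by auto
  then have "d i (u N i) (z i) \<le> 1" for i
    by (intro close[of N]) (auto intro: less_imp_le)
  then have z_in: "z \<in> X_inf"
    using S.limitin_mspace[OF z] z_thread by (intro inv_limitI_bounded[OF u_in])
  have "\<exists>N. \<forall>n\<ge>N. u n \<in> X_inf \<and> d_inf (u n) z < \<epsilon>" if "\<epsilon> > 0" for \<epsilon>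
  proof -
    obtain N where N: "\<forall>n\<ge>N. \<forall>m\<ge>N. d_inf (u n) (u m) < \<epsilon> / 2"
      using cauchy[rule_format, of "\<epsilon> / 2"] \<open>\<epsilon> > 0\<close> by auto
    have "d_inf (u n) z \<le> \<epsilon> / 2" if "n \<ge> N" for n
      by (rule inv_limit_dist_least[OF u_in z_in], rule close[of N])
        (use N that in \<open>auto intro: less_imp_le\<close>)
    then have "d_inf (u n) z < \<epsilon>" if "n \<ge> N" for n
      using \<open>\<epsilon> > 0\<close> that by fastforce
    then show ?thesis
      using u_in by blast
  qed
  then show "\<exists>z. limitin L.mtopology u z sequentially"
    using z_in unfolding L.limit_metric_sequentially by blast
qed

lemma bond_in:
  assumes "i \<le> n" "x \<in> X n"
  shows "bond p n i x \<in> X i"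
  using assms(1)
proof (induction rule: inc_induct)
  case (step i)
  then show ?case
    by (simp add: bond_step[of i n] bonding_in)
qed (simp add: assms(2))

lemma bond_short:
  assumes "i \<le> n" "x \<in> X n" "y \<in> X n"
  shows "d i (bond p n i x) (bond p n i y) \<le> d n x y"
  using assms(1)
proof (induction rule: inc_induct)
  case (step i)
  then have "bond p n (Suc i) x \<in> X (Suc i)" "bond p n (Suc i) y \<in> X (Suc i)"
    using assms by (auto intro: bond_in)
  then have "d i (bond p n i x) (bond p n i y) \<le> d (Suc i) (bond p n (Suc i) x) (bond p n (Suc i) y)"
    using step.hyps by (simp add: bond_step[of i n] bonding_short)
  with step.IH show ?case
    by simp
qed simp

lemma bond_thread:
  assumes "i \<le> n" "x \<in> X_inf"
  shows "bond p n i (x n) = x i"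
  using assms(1)
proof (induction rule: inc_induct)
  case (step i)
  then show ?case
    using assms(2) by (simp add: bond_step[of i n] inv_limit_thread)
qed simp

text \<open>
  The limit of the images of geodesics in the approximating spaces. Its Lipschitz constant is at most
  \<open>d_inf x y\<close> in every coordinate, hence for the supremum metric, and its endpoints are at this very
  distance, which forces constant speed.
\<close>

lemma inv_limit_constant_speed_path:
  assumes proper: "\<And>i. proper_space (X i) (d i)"
    and x: "x \<in> X_inf" and y: "y \<in> X_inf"
    and \<gamma>_in: "\<And>n t. t \<in> {0..1} \<Longrightarrow> \<gamma> n t \<in> X n"
    and \<gamma>_speed: "\<And>n s t. s \<in> {0..1} \<Longrightarrow> t \<in> {0..1} \<Longrightarrow>
                    d n (\<gamma> n s) (\<gamma> n t) = d n (x n) (y n) * \<bar>s - t\<bar>"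
    and \<gamma>_ends: "\<And>n. \<gamma> n 0 = x n" "\<And>n. \<gamma> n 1 = y n"
  obtains \<eta> \<sigma> where "strict_mono \<sigma>"
    and "\<And>t. t \<in> {0..1} \<Longrightarrow> \<eta> t \<in> X_inf"
    and "\<And>s t. s \<in> {0..1} \<Longrightarrow> t \<in> {0..1} \<Longrightarrow> d_inf (\<eta> s) (\<eta> t) = d_inf x y * \<bar>s - t\<bar>"
    and "\<eta> 0 = x" and "\<eta> 1 = y"
    and "\<And>i t. t \<in> {0..1} \<Longrightarrow>
           limitin (S.mtopology i) (\<lambda>n. bond p (\<sigma> n) i (\<gamma> (\<sigma> n) t)) (\<eta> t i) sequentially"
proof -
  \<comment> \<open>The value \<open>x i\<close> for the finitely many \<open>n < i\<close> keeps all terms of the sequence in one ball of \<open>X i\<close>.\<close>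
  define f where "f i n t = (if i \<le> n then bond p n i (\<gamma> n t) else x i)" for i n t
  have f_in: "f i n t \<in> X i" if "t \<in> {0..1}" for i n t
    using that by (simp add: f_def bond_in \<gamma>_in inv_limit_in x)
  have f_lip: "d i (f i n s) (f i n t) \<le> d_inf x y * \<bar>s - t\<bar>"
    if st: "s \<in> {0..1}" "t \<in> {0..1}" for i n s t
  proof (cases "i \<le> n")
    case True
    then have "d i (f i n s) (f i n t) \<le> d n (x n) (y n) * \<bar>s - t\<bar>"
      using bond_short[OF True \<gamma>_in[OF st(1)] \<gamma>_in[OF st(2)]] by (simp add: f_def \<gamma>_speed[OF st])
    also have "\<dots> \<le> d_inf x y * \<bar>s - t\<bar>"
      by (intro mult_right_mono coordinate_dist_le x y) auto
    finally show ?thesis .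
  qed (simp add: f_def inv_limit_in x)
  have f_0: "f i n 0 = x i" for i n
    using bond_thread x by (simp add: f_def \<gamma>_ends)
  have f_near: "d i (x i) (f i n t) \<le> d_inf x y" if t: "t \<in> {0..1}" for i n t
  proof -
    have "d i (f i n 0) (f i n t) \<le> d_inf x y * \<bar>0 - t\<bar>"
      using t by (intro f_lip) auto
    also have "\<dots> \<le> d_inf x y"
      using t by (auto intro!: mult_left_le)
    finally show ?thesis
      by (simp add: f_0)
  qed
  have compact: "compactin (S.mtopology i) (S.mcball i (x i) (d_inf x y))" for i
    using proper x inv_limit_in by (simp add: proper_space_def)
  have f_ball: "f i n t \<in> S.mcball i (x i) (d_inf x y)" if "t \<in> {0..1}" for i n t
    using f_in[OF that] f_near[OF that] inv_limit_in[OF x] by simp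
  obtain \<sigma> h where \<sigma>: "strict_mono \<sigma>"
    and h: "\<And>i t. t \<in> {0..1} \<Longrightarrow>
              limitin (S.mtopology i) (\<lambda>n. f i (\<sigma> n) t) (h i t) sequentially"
    by (rule arzela_ascoli_diagonal[where f = f, OF metric compact f_ball f_lip])
      (assumption+, rule that)
  have tail: "eventually (\<lambda>n. i \<le> \<sigma> n) sequentially" for i
    using filterlim_subseq[OF \<sigma>] by (simp add: filterlim_at_top)
  have h_lip: "d i (h i s) (h i t) \<le> d_inf x y * \<bar>s - t\<bar>"
    if "s \<in> {0..1}" "t \<in> {0..1}" for i s t
    by (rule S.limitin_dist_le[OF h[OF that(1)] h[OF that(2)] f_lip[OF that]])
  have h_unique: "h i t = l"
    if "t \<in> {0..1}" "l \<in> X i" "eventually (\<lambda>n. f i (\<sigma> n) t = l) sequentially" for i t l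
  proof -
    have "limitin (S.mtopology i) (\<lambda>n. f i (\<sigma> n) t) l sequentially"
      using that by (intro limitin_eventually) auto
    from S.limitin_metric_unique[OF h[OF that(1)] this trivial_limit_sequentially]
    show ?thesis .
  qed
  have h_0: "h i 0 = x i" and h_1: "h i 1 = y i" for i
  proof -
    show "h i 0 = x i"
      using inv_limit_in x by (intro h_unique) (auto simp: f_0)
    show "h i 1 = y i"
      using inv_limit_in y
      by (intro h_unique eventually_mono[OF tail[of i]]) (auto simp: f_def \<gamma>_ends bond_thread y)
  qed
  have h_thread: "p (Suc i) (h (Suc i) t) = h i t" if "t \<in> {0..1}" for i t
  proof (rule limit_thread[OF h[OF that]])
    show "\<forall>\<^sub>F n in sequentially. p (Suc i) (f (Suc i) (\<sigma> n) t) = f i (\<sigma> n) t" for i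
      using tail[of "Suc i"] by eventually_elim (simp add: f_def bond_step[of i])
  qed
  have h_in: "(\<lambda>i. h i t) \<in> X_inf" if "t \<in> {0..1}" for t
  proof (rule inv_limitI_bounded[OF x])
    show "d i (x i) (h i t) \<le> d_inf x y * \<bar>0 - t\<bar>" for i
      using h_lip[of 0 t i] that by (simp add: h_0)
  qed (use S.limitin_mspace[OF h] h_thread that in auto)
  show thesis
  proof (rule that[OF \<sigma> h_in])
    let ?\<eta> = "\<lambda>t i. h i t"
    show "?\<eta> 0 = x" and "?\<eta> 1 = y"
      by (simp_all add: h_0 h_1)
    then show "d_inf (?\<eta> s) (?\<eta> t) = d_inf x y * \<bar>s - t\<bar>" if "s \<in> {0..1}" "t \<in> {0..1}" for s t
      using L.constant_speed_if_lipschitz_const_minimal[of ?\<eta> s t] h_in that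
        inv_limit_dist_least[OF h_in h_in h_lip] by simp
    show "limitin (S.mtopology i) (\<lambda>n. bond p (\<sigma> n) i (\<gamma> (\<sigma> n) t)) (h i t) sequentially"
      if "t \<in> {0..1}" for i t
    proof (rule limitin_transform_eventually[OF _ h[OF that]])
      show "\<forall>\<^sub>F n in sequentially. f i (\<sigma> n) t = bond p (\<sigma> n) i (\<gamma> (\<sigma> n) t)"
        using tail[of i] by eventually_elim (simp add: f_def)
    qed
  qed
qed

end

theorem proposition2p9:
  fixes X :: "nat \<Rightarrow> 'a set"
    and d :: "nat \<Rightarrow> 'a \<Rightarrow> 'a \<Rightarrow> real"
    and star :: "nat \<Rightarrow> 'a"
    and p :: "nat \<Rightarrow> 'a \<Rightarrow> 'a"
  assumes "\<And>i. Metric_space (X i) (d i)"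
    and "\<And>i. star i \<in> X i"
    and "\<And>i. geodesic_space (X i) (d i)"
    and "\<And>i. proper_space (X i) (d i)"
    and "\<And>i. p (Suc i) (star (Suc i)) = star i"
    and "\<And>i. continuous_path_lifting (X (Suc i)) (d (Suc i)) (X i) (d i) (p (Suc i))"
  shows "Metric_space (inv_limit X d star p) (inv_limit_dist X d star p) \<and>
    Metric_space.mcomplete (inv_limit X d star p) (inv_limit_dist X d star p) \<and>
    geodesic_space (inv_limit X d star p) (inv_limit_dist X d star p) \<and>
    (\<forall>x\<in>inv_limit X d star p. \<forall>y\<in>inv_limit X d star p.
       \<exists>(\<eta> :: real \<Rightarrow> nat \<Rightarrow> 'a) (\<sigma> :: nat \<Rightarrow> nat) (\<gamma> :: nat \<Rightarrow> real \<Rightarrow> 'a).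
         strict_mono \<sigma> \<and>
         geodesic_on (inv_limit X d star p) (inv_limit_dist X d star p) 0 1 \<eta> x y \<and>
         proportional_to_arc_length (inv_limit_dist X d star p) 0 1 \<eta> \<and>
         (\<forall>n. geodesic_on (X (\<sigma> n)) (d (\<sigma> n)) 0 1 (\<gamma> n) (x (\<sigma> n)) (y (\<sigma> n)) \<and>
              proportional_to_arc_length (d (\<sigma> n)) 0 1 (\<gamma> n)) \<and>
         (\<forall>i. \<forall>t\<in>{0..1}.
            limitin (Metric_space.mtopology (X i) (d i))
              (\<lambda>n. bond p (\<sigma> n) i (\<gamma> n t)) (inv_limit_proj i (\<eta> t)) sequentially))"
    (is "_ \<and> _ \<and> _ \<and> (\<forall>x\<in>?X. \<forall>y\<in>?X. ?approx x y)")
proof -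
  have sub: "submetry (X (Suc i)) (d (Suc i)) (X i) (d i) (p (Suc i))" for i
    using assms(6) by (simp add: continuous_path_lifting_def unique_path_lifting_def)
  interpret inverse_sequence X d star p
  proof (rule inverse_sequence.intro)
    show "p (Suc i) x \<in> X i" if "x \<in> X (Suc i)" for i x
      using sub[of i] that by (auto simp: submetry_def)
    show "d i (p (Suc i) x) (p (Suc i) y) \<le> d (Suc i) x y"
      if "x \<in> X (Suc i)" "y \<in> X (Suc i)" for i x y
      using sub[of i] that by (simp add: submetry_def)
  qed (fact assms)+
  have approx: "?approx x y" if x: "x \<in> X_inf" and y: "y \<in> X_inf" for x y
  proof -
    have "\<exists>c. (\<forall>t\<in>{0..1}. c t \<in> X n) \<and>
            (\<forall>s\<in>{0..1}. \<forall>t\<in>{0..1}. d n (c s) (c t) = d n (x n) (y n) * \<bar>s - t\<bar>) \<and>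
            c 0 = x n \<and> c 1 = y n" for n
    proof -
      obtain a b g where "geodesic_on (X n) (d n) a b g (x n) (y n)"
        using assms(3) inv_limit_in x y unfolding geodesic_space_def by metis
      then show ?thesis
        by (rule S.geodesic_reparametrize) blast
    qed
    then have "\<forall>n. \<exists>c. (\<forall>t\<in>{0..1}. c t \<in> X n) \<and>
            (\<forall>s\<in>{0..1}. \<forall>t\<in>{0..1}. d n (c s) (c t) = d n (x n) (y n) * \<bar>s - t\<bar>) \<and>
            c 0 = x n \<and> c 1 = y n"
      by blast
    from choice[OF this] obtain \<gamma> where \<gamma>_in: "\<And>n t. t \<in> {0..1} \<Longrightarrow> \<gamma> n t \<in> X n"
      and \<gamma>_speed: "\<And>n s t. s \<in> {0..1} \<Longrightarrow> t \<in> {0..1} \<Longrightarrow>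
                      d n (\<gamma> n s) (\<gamma> n t) = d n (x n) (y n) * \<bar>s - t\<bar>"
      and \<gamma>_ends: "\<And>n. \<gamma> n 0 = x n" "\<And>n. \<gamma> n 1 = y n"
      by blast
    obtain \<eta> \<sigma> where \<sigma>: "strict_mono \<sigma>"
      and \<eta>: "\<And>t. t \<in> {0..1} \<Longrightarrow> \<eta> t \<in> X_inf"
        "\<And>s t. s \<in> {0..1} \<Longrightarrow> t \<in> {0..1} \<Longrightarrow> d_inf (\<eta> s) (\<eta> t) = d_inf x y * \<bar>s - t\<bar>"
        "\<eta> 0 = x" "\<eta> 1 = y"
      and lim: "\<And>i t. t \<in> {0..1} \<Longrightarrow>
        limitin (S.mtopology i) (\<lambda>n. bond p (\<sigma> n) i (\<gamma> (\<sigma> n) t)) (\<eta> t i) sequentially"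
      by (rule inv_limit_constant_speed_path[OF assms(4) x y \<gamma>_in \<gamma>_speed \<gamma>_ends])
        (assumption+, rule that)
    show ?thesis
      using \<sigma> lim L.constant_speed_geodesic[OF \<eta>] S.constant_speed_geodesic[OF \<gamma>_in \<gamma>_speed \<gamma>_ends]
      by (intro exI[of _ \<eta>] exI[of _ \<sigma>] exI[of _ "\<lambda>n. \<gamma> (\<sigma> n)"]) (simp add: inv_limit_proj_def)
  qed
  have "geodesic_space X_inf d_inf"
    unfolding geodesic_space_def
  proof (intro ballI)
    fix x y assume "x \<in> X_inf" "y \<in> X_inf"
    from approx[OF this] show "\<exists>a b g. geodesic_on X_inf d_inf a b g x y"
      by (elim exE conjE) (rule exI, rule exI, rule exI)
  qed
  moreover have "L.mcomplete"
    by (intro mcomplete_inv_limit S.proper_space_mcomplete assms(4))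
  ultimately show ?thesis
    using approx L.Metric_space_axioms by (intro conjI ballI)
qed

end
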